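(* Let $A\in\mathbb{C}^{n\times n}$ have index $k$ and satisfy $\operatorname{rank}(A^{\sim}AA^{\sim})=\operatorname{rank}(A)$, and let $\overline{A}=I_n-A$. Then $$A^{D,\mathfrak{m}}=AA^{\mathfrak{m}}(I_n-\overline{A}AA^{\mathfrak{m}})^{D}=(I_n-\overline{A}AA^{\mathfrak{m}})^{D}AA^{\mathfrak{m}}.$$
   Context: The index of $A\in\mathbb{C}^{n\times n}$ is the smallest nonnegative integer $k$ with $\operatorname{rank}(A^{k+1})=\operatorname{rank}(A^{k})$. The Minkowski metric matrix of order $n$ is $G=\operatorname{diag}(1,-I_{n-1})$. For $A\in\mathbb{C}^{n\times n}$, the Minkowski adjoint is $A^{\sim}=GA^{*}G$, where $A^*$ is the conjugate transpose. The Drazin inverse $A^{D}$ of a square matrix $A$ of index $k$ is the unique $X$ with $XAX=X$, $AX=XA$, $A^{k+1}X=A^{k}$. The Minkowski inverse $A^{\mathfrak{m}}$ is the unique matrix $X$ (if it exists) with $AXA=A$, $XAX=X$, $(AX)^{\sim}=AX$, $(XA)^{\sim}=XA$; it exists if and only if $\operatorname{rank}(A^{\sim}AA^{\sim})=\operatorname{rank}(A)$. When it exists, the $\mathfrak{m}$-DMP inverse of $A$ is $A^{D,\mathfrak{m}}=A^{D}AA^{\mathfrak{m}}$. *)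

theory Defs
  imports
    Complex_Main
    "Jordan_Normal_Form.Matrix"
    "Jordan_Normal_Form.DL_Rank"
    "Jordan_Normal_Form.Schur_Decomposition"
begin

(* All notions below concern square matrices; the order n is read off as dim_row A. *)

abbreviation mat_rank :: "complex mat \<Rightarrow> nat" where
  "mat_rank A \<equiv> vec_space.rank (dim_row A) A"

definition mat_index :: "complex mat \<Rightarrow> nat" where
  "mat_index A = (LEAST k. mat_rank (A ^\<^sub>m (k + 1)) = mat_rank (A ^\<^sub>m k))"

definition minkowski_metric :: "nat \<Rightarrow> complex mat" where
  "minkowski_metric n = mat_diag n (\<lambda>i. if i = 0 then 1 else - 1)"

(* The library's mat_adjoint is the conjugate transpose. *)
definition minkowski_adjoint :: "complex mat \<Rightarrow> complex mat" where
  "minkowski_adjoint A =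
     minkowski_metric (dim_row A) * mat_adjoint A * minkowski_metric (dim_row A)"

definition is_drazin_inverse :: "complex mat \<Rightarrow> complex mat \<Rightarrow> bool" where
  "is_drazin_inverse A X \<longleftrightarrow>
     X \<in> carrier_mat (dim_row A) (dim_row A) \<and>
     X * A * X = X \<and> A * X = X * A \<and>
     A ^\<^sub>m (mat_index A + 1) * X = A ^\<^sub>m mat_index A"

definition drazin_inverse :: "complex mat \<Rightarrow> complex mat" where
  "drazin_inverse A = (THE X. is_drazin_inverse A X)"

definition is_minkowski_inverse :: "complex mat \<Rightarrow> complex mat \<Rightarrow> bool" where
  "is_minkowski_inverse A X \<longleftrightarrow>
     X \<in> carrier_mat (dim_row A) (dim_row A) \<and>
     A * X * A = A \<and> X * A * X = X \<and>
     minkowski_adjoint (A * X) = A * X \<and> minkowski_adjoint (X * A) = X * A"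

(* Meaningful only if a Minkowski inverse exists, i.e. if A~ A A~ and A have equal rank. *)
definition minkowski_inverse :: "complex mat \<Rightarrow> complex mat" where
  "minkowski_inverse A = (THE X. is_minkowski_inverse A X)"

definition m_DMP_inverse :: "complex mat \<Rightarrow> complex mat" where
  "m_DMP_inverse A = drazin_inverse A * A * minkowski_inverse A"

end

theory Submission
  imports Defs
begin

text \<open>
  Write \<open>M\<close> for the Minkowski inverse of \<open>A\<close>, \<open>D\<close> for its Drazin inverse and \<open>P = A M\<close>. From
  \<open>A M A = A\<close> it follows that \<open>P\<close> is idempotent with \<open>P A = A\<close>, so \<open>P\<close> is a projector onto the range
  of \<open>A\<close>. The matrix whose Drazin inverse is wanted is
  \<open>1 - (1 - A) A M = (1 - P) + A P\<close>: it acts as \<open>A\<close> on the range of \<open>P\<close> and as the identity on the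
  kernel of \<open>P\<close>. More generally, \<open>T \<mapsto> (1 - P) + T P\<close> is multiplicative on the matrices that
  leave the range of \<open>P\<close> invariant and sends \<open>1\<close> to \<open>1\<close>. Both \<open>A\<close> and \<open>D\<close> leave it invariant, since
  \<open>P A = A\<close> and \<open>D = A D D\<close>. Hence the three equations of a Drazin inverse are carried over
  and the Drazin inverse of \<open>(1 - P) + A P\<close> is \<open>(1 - P) + D P\<close>
  (\<open>drazin_inverse_extend_by_identity\<close>). Multiplying it by \<open>P\<close> on either side
  gives \<open>D P = D A M\<close>, because \<open>P D = D\<close>.

  As both inverses are definite descriptions, this argument needs their existence and uniqueness.
  Existence comes from rank conditions through one principle: if \<open>A B\<close> and \<open>A\<close> have equal rank then
  \<open>A = A B U\<close> for some \<open>U\<close> (\<open>right_factor_if_rank_mult_eq\<close>). The mirror image, \<open>A = V B A\<close>, follows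
  by applying the Minkowski adjoint, which reverses products and preserves rank. With
  \<open>S\<close> the Minkowski adjoint of \<open>A\<close>, the hypothesis yields \<open>S = S A S U = V S A S\<close>, and
  \<open>V S = S U\<close> is the Minkowski inverse (\<open>minkowski_inverse_exists\<close>). For the Drazin inverse, stabilisation of
  the ranks of powers yields \<open>A\<^sup>k = A\<^sup>k\<^sup>+\<^sup>1 U = V A\<^sup>k\<^sup>+\<^sup>1\<close>, that is, \<open>A\<close> is strongly
  \<open>\<pi>\<close>-regular, and \<open>A\<^sup>k U\<^sup>k\<^sup>+\<^sup>1\<close> is its Drazin inverse
  (\<open>drazin_inverse_if_strongly_pi_regular\<close>). Uniqueness holds with any exponent in
  place of the index, so the index of \<open>(1 - P) + A P\<close> never has to be computed.
\<close>

section \<open>Rank and factorisations\<close>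

lemma (in vec_space) column_basis_exists:
  assumes A: "A \<in> carrier_mat n nc"
  obtains S where "S \<subseteq> set (cols A)" "lin_indpt S" "card S = rank A" "set (cols A) \<subseteq> span S"
proof -
  have cols: "set (cols A) \<subseteq> carrier_vec n"
    using A cols_dim by blast
  obtain S where S: "maximal S (\<lambda>T. T \<subseteq> set (cols A) \<and> lin_indpt T)"
    using maximal_exists[of "\<lambda>T. T \<subseteq> set (cols A) \<and> lin_indpt T" "card (set (cols A))" "{}"]
    by (meson List.finite_set card_mono empty_iff empty_subsetI finite_lin_indpt2 rev_finite_subset)
  have sub: "S \<subseteq> set (cols A)" and li: "lin_indpt S"
    using S unfolding maximal_def by auto
  have "v \<in> span S" if v: "v \<in> set (cols A)" for v
  proof (rule ccontr)
    assume nv: "v \<notin> span S"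
    have Sc: "S \<subseteq> carrier_vec n" and vc: "v \<in> carrier_vec n"
      using sub cols v by auto
    have "v \<notin> S"
      using nv span_mem[OF Sc] by blast
    hence "lin_indpt (S \<union> {v})"
      using lin_dep_iff_in_span[of S v] Sc vc li nv by auto
    moreover have "S \<union> {v} \<subseteq> set (cols A)"
      using sub v by auto
    ultimately have "S \<union> {v} = S"
      using S unfolding maximal_def by blast
    thus False
      using \<open>v \<notin> S\<close> by auto
  qed
  thus thesis
    using that[OF sub li] rank_card_indpt[OF A S] by auto
qed

lemma (in vec_space) card_le_rank_if_lin_indpt_in_col_space:
  assumes A: "A \<in> carrier_mat n nc" and S: "S \<subseteq> col_space A" and li: "lin_indpt S"
  shows "card S \<le> rank A"
proof -
  let ?W = "span (set (cols A))"
  have cols: "set (cols A) \<subseteq> carrier_vec n"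
    using A cols_dim by blast
  have sub: "submodule class_ring ?W V"
    using cols by (simp add: span_is_submodule)
  interpret W: vectorspace class_ring "vs ?W"
    using span_is_subspace[THEN subspace_is_vs] cols by auto
  have "W.lin_indpt S"
    using span_li_not_depend(2)[OF _ sub, of S] S li unfolding col_space_def by auto
  thus ?thesis
    using W.li_le_dim(2)[of S] fin_dim_span_cols[OF A] S
    unfolding rank_def col_space_def by auto
qed

lemma factor_through_if_cols_in_col_space:
  fixes A :: "'a::field mat"
  assumes A: "A \<in> carrier_mat n m" and B: "B \<in> carrier_mat n k"
    and sub: "set (cols B) \<subseteq> vec_space.col_space n A"
  shows "\<exists>C \<in> carrier_mat m k. B = A * C"
proof -
  interpret vec_space "TYPE('a)" n .
  have "\<exists>x\<in>carrier_vec m. A *\<^sub>v x = col B j" if "j < k" for j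
  proof -
    have "col B j \<in> set (cols B)"
      using that B by (auto simp: cols_def)
    thus ?thesis
      using sub col_space_eq[OF A] A by auto
  qed
  then obtain x where x: "\<And>j. j < k \<Longrightarrow> x j \<in> carrier_vec m \<and> A *\<^sub>v x j = col B j"
    by metis
  let ?C = "mat_of_cols m (map x [0..<k])"
  have C: "?C \<in> carrier_mat m k"
    by auto
  have "B = A * ?C"
  proof (rule mat_col_eqI)
    fix j assume "j < dim_col (A * ?C)"
    hence j: "j < k"
      using C by auto
    have "col (A * ?C) j = A *\<^sub>v col ?C j"
      using col_mult2[OF A C] j by auto
    also have "col ?C j = x j"
      using j x by (subst col_mat_of_cols) auto
    finally show "col B j = col (A * ?C) j"
      using x j by auto
  qed (use A B C in auto)
  thus ?thesis
    using C by blast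
qed

lemma (in vec_space) col_space_mult_subset:
  assumes A: "A \<in> carrier_mat n m" and B: "B \<in> carrier_mat m k"
  shows "col_space (A * B) \<subseteq> col_space A"
proof 
  fix y assume "y \<in> col_space (A * B)"
  then obtain x where x: "x \<in> carrier_vec k" and y: "y = A * B *\<^sub>v x"
    using col_space_eq[of "A * B" k] A B by auto
  have "y = A *\<^sub>v (B *\<^sub>v x)"
    using y A B x by auto
  thus "y \<in> col_space A"
    using col_space_eq[OF A] A B x by auto
qed

lemma (in vec_space) cols_in_col_space:
  assumes "A \<in> carrier_mat n m"
  shows "set (cols A) \<subseteq> col_space A"
  using in_own_span[of "set (cols A)"] cols_dim[of A] assms unfolding col_space_def by auto

lemma rank_mult_le:
  fixes A :: "'a::field mat"
  assumes A: "A \<in> carrier_mat n m" and B: "B \<in> carrier_mat m k"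
  shows "vec_space.rank n (A * B) \<le> vec_space.rank n A"
proof -
  interpret vec_space "TYPE('a)" n .
  have AB: "A * B \<in> carrier_mat n k"
    using A B by auto
  obtain S where "S \<subseteq> set (cols (A * B))" "lin_indpt S" "card S = rank (A * B)"
    using column_basis_exists[OF AB] by metis
  thus ?thesis
    using card_le_rank_if_lin_indpt_in_col_space[OF A, of S] cols_in_col_space[OF AB]
      col_space_mult_subset[OF A B] by auto
qed

text \<open>
  A basis of the column space of \<open>A * B\<close> is an independent subset of the column space of \<open>A\<close>. When
  the ranks agree it cannot be enlarged there, so it already spans every column of \<open>A\<close>.
\<close>

lemma right_factor_if_rank_mult_eq:
  fixes A :: "'a::field mat"
  assumes A: "A \<in> carrier_mat n m" and B: "B \<in> carrier_mat m k"
    and rank: "vec_space.rank n (A * B) = vec_space.rank n A"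
  shows "\<exists>U \<in> carrier_mat k m. A = A * B * U"
proof -
  interpret vec_space "TYPE('a)" n .
  have AB: "A * B \<in> carrier_mat n k"
    using A B by auto
  obtain S where S: "S \<subseteq> set (cols (A * B))" "lin_indpt S" "card S = rank A"
    using column_basis_exists[OF AB] rank by metis
  have fin: "finite S"
    using S(1) finite_subset by blast
  have SA: "S \<subseteq> col_space A"
    using S(1) cols_in_col_space[OF AB] col_space_mult_subset[OF A B] by auto
  have Sc: "S \<subseteq> carrier_vec n"
    using S(1) AB cols_dim by blast
  have "v \<in> span S" if v: "v \<in> set (cols A)" for v
  proof (rule ccontr)
    assume nv: "v \<notin> span S"
    have vc: "v \<in> carrier_vec n"
      using v A cols_dim by blast
    have nS: "v \<notin> S"
      using nv span_mem[OF Sc] by blast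
    hence "lin_indpt (S \<union> {v})"
      using lin_dep_iff_in_span[of S v] Sc vc S(2) nv by auto
    hence "card (S \<union> {v}) \<le> rank A"
      using card_le_rank_if_lin_indpt_in_col_space[OF A] SA v cols_in_col_space[OF A] by auto
    thus False
      using S(3) nS fin by auto
  qed
  moreover have "span S \<subseteq> col_space (A * B)"
    unfolding col_space_def by (rule span_is_monotone[OF S(1)])
  ultimately show ?thesis
    using factor_through_if_cols_in_col_space[OF AB A] by auto
qed

text \<open>
  This is what makes the rank of an adjoint accessible: the adjoint of a factorisation through
  dimension \<open>r\<close> is again one, with the factors exchanged.
\<close>

lemma rank_factorization:
  fixes A :: "'a::field mat"
  assumes A: "A \<in> carrier_mat n m" and r: "r = vec_space.rank n A"
  shows "\<exists>B \<in> carrier_mat n r. \<exists>C \<in> carrier_mat r m. A = B * C"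
proof -
  interpret vec_space "TYPE('a)" n .
  obtain S where S: "S \<subseteq> set (cols A)" "card S = r" "set (cols A) \<subseteq> span S"
    using column_basis_exists[OF A] r by metis
  obtain xs where xs: "set xs = S" "distinct xs"
    using finite_distinct_list S(1) finite_subset by (metis List.finite_set)
  have len: "length xs = r"
    using xs S(2) distinct_card by fastforce
  have "S \<subseteq> carrier_vec n"
    using S(1) A cols_dim by blast
  hence "cols (mat_of_cols n xs) = xs"
    using xs by (intro cols_mat_of_cols) auto
  hence "set (cols A) \<subseteq> col_space (mat_of_cols n xs)"
    using S(3) xs(1) unfolding col_space_def by simp
  moreover have "mat_of_cols n xs \<in> carrier_mat n r"
    using len by auto
  ultimately show ?thesis
    using factor_through_if_cols_in_col_space[OF _ A] by blast
qed

section \<open>The Minkowski adjoint\<close>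

lemma mat_adjoint_eq_mat:
  "mat_adjoint A = mat (dim_col A) (dim_row A) (\<lambda>(i, j). conjugate (A $$ (j, i)))"
  unfolding mat_adjoint_def by (rule eq_matI) (auto simp: mat_of_rows_index)

lemma mat_adjoint_carrier [simp]: "A \<in> carrier_mat n m \<Longrightarrow> mat_adjoint A \<in> carrier_mat m n"
  by (auto simp: mat_adjoint_eq_mat)

lemma mat_adjoint_adjoint: "mat_adjoint (mat_adjoint A) = A"
  by (rule eq_matI) (auto simp: mat_adjoint_eq_mat)

lemma mat_adjoint_mult:
  assumes "A \<in> carrier_mat n m" and "B \<in> carrier_mat m k"
  shows "mat_adjoint (A * B) = mat_adjoint B * mat_adjoint A"
  by (rule eq_matI)
    (use assms in \<open>auto simp: mat_adjoint_eq_mat scalar_prod_def mult.commute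
      conjugate_dist_mul sum_conjugate\<close>)

lemma minkowski_metric_carrier [simp]: "minkowski_metric n \<in> carrier_mat n n"
  unfolding minkowski_metric_def by simp

lemma minkowski_metric_dim [simp]:
  "dim_row (minkowski_metric n) = n" "dim_col (minkowski_metric n) = n"
  using carrier_matD[OF minkowski_metric_carrier[of n]] .

lemma minkowski_metric_square: "minkowski_metric n * minkowski_metric n = 1\<^sub>m n"
  unfolding minkowski_metric_def mat_diag_diag by (rule eq_matI) (auto simp: mat_diag_def)

lemma mat_adjoint_minkowski_metric: "mat_adjoint (minkowski_metric n) = minkowski_metric n"
  by (rule eq_matI) (auto simp: mat_adjoint_eq_mat minkowski_metric_def mat_diag_def)

lemma minkowski_adjoint_carrier [simp]:
  "A \<in> carrier_mat n n \<Longrightarrow> minkowski_adjoint A \<in> carrier_mat n n"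
  unfolding minkowski_adjoint_def
  by (metis carrier_matD(1) mat_adjoint_carrier minkowski_metric_carrier mult_carrier_mat)

lemma minkowski_adjoint_mult:
  assumes A: "A \<in> carrier_mat n n" and B: "B \<in> carrier_mat n n"
  shows "minkowski_adjoint (A * B) = minkowski_adjoint B * minkowski_adjoint A"
proof -
  let ?G = "minkowski_metric n"
  note assoc = assoc_mult_mat[of _ n n _ n _ n] mult_carrier_mat[of _ n n _ n]
    mat_adjoint_carrier[of _ n n] left_mult_one_mat[of _ n n] A B
  have "?G * (mat_adjoint B * mat_adjoint A) * ?G
      = ?G * mat_adjoint B * (1\<^sub>m n * (mat_adjoint A * ?G))"
    by (simp add: assoc)
  also have "\<dots> = ?G * mat_adjoint B * ?G * (?G * mat_adjoint A * ?G)"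
    unfolding minkowski_metric_square[symmetric] by (simp add: assoc)
  finally show ?thesis
    using A B unfolding minkowski_adjoint_def by (simp add: mat_adjoint_mult[of _ n n _ n])
qed

lemma minkowski_adjoint_adjoint:
  assumes A: "A \<in> carrier_mat n n"
  shows "minkowski_adjoint (minkowski_adjoint A) = A"
proof -
  let ?G = "minkowski_metric n"
  note assoc = assoc_mult_mat[of _ n n _ n _ n] mult_carrier_mat[of _ n n _ n]
    mat_adjoint_carrier[of _ n n] A
  have "mat_adjoint (?G * mat_adjoint A * ?G) = ?G * A * ?G"
    by (simp add: mat_adjoint_mult[of _ n n _ n] mat_adjoint_adjoint
      mat_adjoint_minkowski_metric assoc)
  hence "minkowski_adjoint (minkowski_adjoint A) = ?G * (?G * A * ?G) * ?G"
    using A unfolding minkowski_adjoint_def by simp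
  also have "\<dots> = (?G * ?G) * (A * (?G * ?G))"
    by (simp add: assoc)
  finally show ?thesis
    using A unfolding minkowski_metric_square by simp
qed

lemma rank_minkowski_adjoint:
  assumes A: "A \<in> carrier_mat n n"
  shows "vec_space.rank n (minkowski_adjoint A) = vec_space.rank n A"
proof -
  have le: "vec_space.rank n (minkowski_adjoint A) \<le> vec_space.rank n A"
    if A: "A \<in> carrier_mat n n" for A
  proof -
    let ?G = "minkowski_metric n"
    define r where "r = vec_space.rank n A"
    obtain B C where B: "B \<in> carrier_mat n r" and C: "C \<in> carrier_mat r n" and "A = B * C"
      using rank_factorization[OF A r_def] by blast
    hence "minkowski_adjoint A = ?G * (mat_adjoint C * mat_adjoint B) * ?G"
      unfolding minkowski_adjoint_def by (simp add: mat_adjoint_mult)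
    also have "?G * (mat_adjoint C * mat_adjoint B) = ?G * mat_adjoint C * mat_adjoint B"
      using mat_adjoint_carrier[OF B] mat_adjoint_carrier[OF C]
      by (intro assoc_mult_mat[of _ n n _ r _ n, symmetric]) auto
    also have "?G * mat_adjoint C * mat_adjoint B * ?G
        = (?G * mat_adjoint C) * (mat_adjoint B * ?G)"
      using mult_carrier_mat[of ?G n n "mat_adjoint C" r] mat_adjoint_carrier[OF B]
        mat_adjoint_carrier[OF C]
      by (intro assoc_mult_mat[of _ n r _ n _ n]) auto
    finally have eq: "minkowski_adjoint A = (?G * mat_adjoint C) * (mat_adjoint B * ?G)" .
    have "vec_space.rank n (minkowski_adjoint A) \<le> vec_space.rank n (?G * mat_adjoint C)"
      unfolding eq using B C mult_carrier_mat[of ?G n n "mat_adjoint C" r]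
        mult_carrier_mat[of "mat_adjoint B" r n ?G n]
      by (intro rank_mult_le[of _ n r _ n]) auto
    also have "\<dots> \<le> r"
      using mult_carrier_mat[of ?G n n "mat_adjoint C" r] C by (intro vec_space.rank_le_nc) auto
    finally show ?thesis
      unfolding r_def .
  qed
  show ?thesis
    using le[OF A] le[OF minkowski_adjoint_carrier[OF A]] minkowski_adjoint_adjoint[OF A] by simp
qed

text \<open>
  The row-space counterpart of \<open>right_factor_if_rank_mult_eq\<close>. The Minkowski adjoint exchanges
  the two sides and preserves ranks.
\<close>

lemma left_factor_if_rank_mult_eq:
  fixes A B :: "complex mat"
  assumes A: "A \<in> carrier_mat n n" and B: "B \<in> carrier_mat n n"
    and rank: "vec_space.rank n (B * A) = vec_space.rank n A"
  shows "\<exists>V \<in> carrier_mat n n. A = V * (B * A)"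
proof -
  let ?a = minkowski_adjoint
  have "vec_space.rank n (?a A * ?a B) = vec_space.rank n (?a A)"
    using A B rank rank_minkowski_adjoint[of "B * A" n]
    by (simp add: minkowski_adjoint_mult rank_minkowski_adjoint)
  then obtain U where U: "U \<in> carrier_mat n n" and "?a A = ?a A * ?a B * U"
    using right_factor_if_rank_mult_eq[of "?a A" n n "?a B" n] A B by auto
  hence "?a (?a A) = ?a U * (?a (?a B) * ?a (?a A))"
    using A B by (metis minkowski_adjoint_mult minkowski_adjoint_carrier mult_carrier_mat)
  thus ?thesis
    using A B U by (metis minkowski_adjoint_adjoint minkowski_adjoint_carrier)
qed

section \<open>The Minkowski inverse\<close>

text \<open>
  As for the Moore-Penrose inverse: two self-adjoint idempotents \<open>A * X\<close> and \<open>A * Y\<close> that absorb one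
  another coincide, and likewise \<open>X * A\<close> and \<open>Y * A\<close>.
\<close>

lemma is_minkowski_inverse_unique:
  assumes A: "A \<in> carrier_mat n n"
    and X: "is_minkowski_inverse A X" and Y: "is_minkowski_inverse A Y"
  shows "X = Y"
proof -
  let ?a = minkowski_adjoint
  have c: "X \<in> carrier_mat n n" "Y \<in> carrier_mat n n"
    using X Y A unfolding is_minkowski_inverse_def by auto
  note rules = A c
  note closed = mult_carrier_mat[of _ n n _ n]
  note assoc = assoc_mult_mat[of _ n n _ n _ n] closed
  have X': "A * X * A = A" "X * A * X = X" "?a (A * X) = A * X" "?a (X * A) = X * A"
    and Y': "A * Y * A = A" "Y * A * Y = Y" "?a (A * Y) = A * Y" "?a (Y * A) = Y * A"
    using X Y unfolding is_minkowski_inverse_def by blast+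
  have prods: "A * X \<in> carrier_mat n n" "A * Y \<in> carrier_mat n n"
    "X * A \<in> carrier_mat n n" "Y * A \<in> carrier_mat n n"
    using rules by auto
  have "A * Y * A * X = (A * Y) * (A * X)"
    using rules by (simp add: assoc)
  hence "A * X = (A * Y) * (A * X)"
    unfolding Y'(1) .
  also have "\<dots> = ?a ((A * X) * (A * Y))"
    unfolding minkowski_adjoint_mult[OF prods(1,2)] X' Y' ..
  also have "(A * X) * (A * Y) = A * X * A * Y"
    using rules by (simp add: assoc)
  also have "\<dots> = A * Y"
    unfolding X'(1) ..
  finally have AX: "A * X = A * Y"
    unfolding Y' .
  have "X * A = (X * A) * (Y * A)"
    using rules Y'(1) by (simp add: assoc)
  also have "\<dots> = ?a ((Y * A) * (X * A))"
    unfolding minkowski_adjoint_mult[OF prods(4,3)] X' Y' ..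
  also have "(Y * A) * (X * A) = Y * A"
    using rules X'(1) by (simp add: assoc)
  finally have XA: "X * A = Y * A"
    unfolding Y' .
  have "X = X * (A * X)"
    using rules X'(2) by (simp add: assoc)
  also have "\<dots> = X * A * Y"
    unfolding AX using rules by (simp add: assoc)
  also have "\<dots> = Y"
    unfolding XA by (rule Y'(2))
  finally show ?thesis .
qed

text \<open>
  Let \<open>S\<close> be the Minkowski adjoint of \<open>A\<close>. As \<open>A\<close> and \<open>S\<close> have equal rank, the hypothesis gives
  \<open>S = V (S A S) = (S A S) U\<close>, and then \<open>X = V S\<close> equals \<open>S U\<close> and satisfies \<open>X A S = S = S A X\<close>. Taking
  adjoints turns these two equations into \<open>A S X\<^sup>\<sim> = A = X\<^sup>\<sim> S A\<close>, writing \<open>X\<^sup>\<sim>\<close> for the adjoint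
  of \<open>X\<close>, whence \<open>X A = S X\<^sup>\<sim>\<close> and \<open>A X = X\<^sup>\<sim> S\<close>. The right-hand sides are the adjoints of
  the left-hand ones, which gives the self-adjointness; the remaining equations are
  substitutions.
\<close>

lemma minkowski_inverse_exists:
  assumes A: "A \<in> carrier_mat n n"
    and rank: "vec_space.rank n (minkowski_adjoint A * A * minkowski_adjoint A) = vec_space.rank n A"
  shows "\<exists>X. is_minkowski_inverse A X"
proof -
  let ?a = minkowski_adjoint
  define S where "S = ?a A"
  have S: "S \<in> carrier_mat n n"
    unfolding S_def using A by simp
  have aS: "?a S = A"
    unfolding S_def using minkowski_adjoint_adjoint[OF A] .
  have SAS: "vec_space.rank n (S * A * S) = vec_space.rank n S"
    using rank rank_minkowski_adjoint[OF A] unfolding S_def by simp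
  obtain V where V: "V \<in> carrier_mat n n" and SV: "S = V * (S * A * S)"
    using left_factor_if_rank_mult_eq[of S n "S * A"] S A SAS by auto
  obtain U where U: "U \<in> carrier_mat n n" and SU: "S = S * (A * S) * U"
    using right_factor_if_rank_mult_eq[of S n n "A * S" n] S A SAS by (auto simp: assoc_mult_mat)
  define X where "X = V * S"
  have X: "X \<in> carrier_mat n n"
    unfolding X_def using V S by simp
  note rules = A S U V X
  note closed = mult_carrier_mat[of _ n n _ n]
  note assoc = assoc_mult_mat[of _ n n _ n _ n] closed
  have "X = V * (S * (A * S) * U)"
    using X_def SU by (rule back_subst[of "\<lambda>T. X = V * T"])
  also have "\<dots> = V * (S * A * S) * U"
    using rules by (simp add: assoc)
  finally have XU: "X = S * U"
    unfolding SV[symmetric] .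
  have "X * A * S = V * (S * A * S)"
    using rules unfolding X_def by (simp add: assoc)
  hence XAS: "X * A * S = S"
    unfolding SV[symmetric] .
  have "S * A * X = S * (A * S) * U"
    using rules unfolding XU by (simp add: assoc)
  hence SAX: "S * A * X = S"
    unfolding SU[symmetric] .
  have aX: "?a X \<in> carrier_mat n n"
    using X by simp
  have 1: "A * (S * ?a X) = A"
    using arg_cong[OF XAS, of ?a] rules aX aS
    by (simp add: closed minkowski_adjoint_mult[of _ n] S_def[symmetric])
  have 2: "?a X * S * A = A"
    using arg_cong[OF SAX, of ?a] rules aX aS
    by (simp add: closed minkowski_adjoint_mult[of _ n] S_def[symmetric] assoc)
  have "X * A = X * (A * (S * ?a X))"
    unfolding 1 ..
  also have "\<dots> = (X * A * S) * ?a X"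
    using rules aX by (simp add: assoc)
  finally have XA: "X * A = S * ?a X"
    unfolding XAS .
  have "A * X = ?a X * S * A * X"
    unfolding 2 ..
  also have "\<dots> = ?a X * (S * A * X)"
    using rules aX by (simp add: assoc)
  finally have AX: "A * X = ?a X * S"
    unfolding SAX .
  have "is_minkowski_inverse A X"
    unfolding is_minkowski_inverse_def
  proof (intro conjI)
    show "X \<in> carrier_mat (dim_row A) (dim_row A)"
      using X A by simp
    show "A * X * A = A"
      using 2 unfolding AX by simp
    have "V * S * A * X = V * (S * A * X)"
      using rules by (simp add: assoc)
    thus "X * A * X = X"
      unfolding SAX by (simp flip: X_def)
    show "?a (A * X) = A * X"
      by (rule trans[OF minkowski_adjoint_mult[OF A X, folded S_def] AX[symmetric]])
    show "?a (X * A) = X * A"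
      by (rule trans[OF minkowski_adjoint_mult[OF X A, folded S_def] XA[symmetric]])
  qed
  thus ?thesis
    by blast
qed

lemma is_minkowski_inverse_minkowski_inverse:
  assumes A: "A \<in> carrier_mat n n"
    and rank: "vec_space.rank n (minkowski_adjoint A * A * minkowski_adjoint A) = vec_space.rank n A"
  shows "is_minkowski_inverse A (minkowski_inverse A)"
proof -
  obtain X where X: "is_minkowski_inverse A X"
    using minkowski_inverse_exists[OF assms] by blast
  show ?thesis
    unfolding minkowski_inverse_def
    using X by (rule theI) (rule is_minkowski_inverse_unique[OF A _ X])
qed

section \<open>Drazin inverses in a monoid\<close>

context monoid
begin

text \<open>
  For commuting \<open>a\<close> and \<open>x\<close> with \<open>x a x = x\<close>, the element \<open>a x\<close> is idempotent, so its powers, which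
  are the products \<open>a\<^sup>m x\<^sup>m\<close>, do not depend on \<open>m > 0\<close>.
\<close>

lemma pow_mult_pow_outer_inverse:
  assumes c: "a \<in> carrier G" "x \<in> carrier G" and xax: "x \<otimes> a \<otimes> x = x" and ax: "a \<otimes> x = x \<otimes> a"
  shows "a [^] Suc m \<otimes> x [^] Suc m = a \<otimes> x" and "x [^] Suc m \<otimes> a [^] Suc m = a \<otimes> x"
proof -
  have idem: "a \<otimes> (a \<otimes> x) \<otimes> x = a \<otimes> x" "x \<otimes> (a \<otimes> x) \<otimes> a = a \<otimes> x"
    using c xax ax by (metis m_assoc m_closed)+
  show "a [^] Suc m \<otimes> x [^] Suc m = a \<otimes> x"
  proof (induction m)
    case (Suc m)
    have "a [^] Suc (Suc m) \<otimes> x [^] Suc (Suc m) = a \<otimes> (a [^] Suc m \<otimes> x [^] Suc m) \<otimes> x"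
      unfolding nat_pow_Suc2[OF c(1), of "Suc m"] nat_pow_Suc[of x "Suc m"]
      using c by (simp add: m_assoc del: nat_pow_Suc)
    thus ?case
      using Suc idem by simp
  qed (use c in simp)
  show "x [^] Suc m \<otimes> a [^] Suc m = a \<otimes> x"
  proof (induction m)
    case (Suc m)
    have "x [^] Suc (Suc m) \<otimes> a [^] Suc (Suc m) = x \<otimes> (x [^] Suc m \<otimes> a [^] Suc m) \<otimes> a"
      unfolding nat_pow_Suc2[OF c(2), of "Suc m"] nat_pow_Suc[of a "Suc m"]
      using c by (simp add: m_assoc del: nat_pow_Suc)
    thus ?case
      using Suc idem by simp
  qed (use c ax in simp)
qed

lemma pow_absorb_mono:
  assumes c: "a \<in> carrier G" "x \<in> carrier G"
    and pow: "a [^] Suc k \<otimes> x = a [^] k" and le: "k \<le> m"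
  shows "a [^] Suc m \<otimes> x = a [^] m"
proof -
  have "a [^] Suc (i + k) \<otimes> x = a [^] i \<otimes> (a [^] Suc k \<otimes> x)" for i :: nat
    using c nat_pow_mult[of a i "Suc k"] by (simp flip: m_assoc del: nat_pow_Suc)
  thus ?thesis
    using pow le c nat_pow_mult[of a "m - k" k] by (metis le_add_diff_inverse2)
qed

text \<open>
  The two exponents may differ, which allows a Drazin inverse to be recognised without knowing
  the index. With \<open>m\<close> above both exponents, the idempotents \<open>e = a x = a\<^sup>m x\<^sup>m\<close> and
  \<open>f = a y = y\<^sup>m a\<^sup>m\<close> satisfy \<open>f a\<^sup>m = a\<^sup>m = a\<^sup>m e\<close>, so that \<open>e = f e = f\<close>. Finally
  \<open>x = x a x\<close> and \<open>y = y a y\<close> both equal \<open>x a y\<close>.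
\<close>

lemma drazin_inverse_unique:
  assumes c: "a \<in> carrier G" "x \<in> carrier G" "y \<in> carrier G"
    and x: "x \<otimes> a \<otimes> x = x" "a \<otimes> x = x \<otimes> a" "a [^] Suc k \<otimes> x = a [^] k"
    and y: "y \<otimes> a \<otimes> y = y" "a \<otimes> y = y \<otimes> a" "a [^] Suc l \<otimes> y = a [^] l"
  shows "x = y"
proof -
  \<comment> \<open>The successor matters when both exponents are 0: \<open>a\<^sup>m x\<^sup>m = a x\<close> needs \<open>m > 0\<close>.\<close>
  define m where "m = Suc (max k l)"
  have xm: "a [^] m \<otimes> x [^] m = a \<otimes> x"
    using pow_mult_pow_outer_inverse(1)[OF c(1,2) x(1,2)] m_def by simp
  have ym: "y [^] m \<otimes> a [^] m = a \<otimes> y"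
    using pow_mult_pow_outer_inverse(2)[OF c(1,3) y(1,2)] m_def by simp
  have ax: "a [^] m \<otimes> (a \<otimes> x) = a [^] m"
    using pow_absorb_mono[OF c(1,2) x(3), of m] c m_def by (simp add: m_assoc)
  have "a \<otimes> y \<otimes> a [^] m = a [^] m \<otimes> (a \<otimes> y)"
    using c y(2) by (intro group_commutes_pow[symmetric]) (metis m_assoc, auto)
  also have "\<dots> = a [^] m"
    using pow_absorb_mono[OF c(1,3) y(3), of m] c m_def by (simp add: m_assoc)
  finally have ay: "a \<otimes> y \<otimes> a [^] m = a [^] m" .
  have "a \<otimes> x = (a \<otimes> y \<otimes> a [^] m) \<otimes> x [^] m"
    unfolding ay xm ..
  also have "\<dots> = a \<otimes> y \<otimes> (a \<otimes> x)"
    using c by (simp add: m_assoc xm)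
  also have "\<dots> = y [^] m \<otimes> (a [^] m \<otimes> (a \<otimes> x))"
    using c by (simp add: ym[symmetric] m_assoc)
  finally have e: "a \<otimes> x = a \<otimes> y"
    unfolding ax ym .
  have "x = x \<otimes> (a \<otimes> x)"
    using x(1) c by (simp add: m_assoc)
  also have "\<dots> = (a \<otimes> x) \<otimes> y"
    using c x(2) e by (simp add: m_assoc)
  also have "\<dots> = y"
    using e y(1,2) by simp
  finally show ?thesis .
qed

text \<open>
  The hypotheses give \<open>a\<^sup>k x = y a\<^sup>k\<close>, hence \<open>a\<^sup>k x\<^sup>j = y\<^sup>j a\<^sup>k\<close>. So \<open>d\<close> can be
  read as \<open>a\<^sup>k x\<^sup>k\<^sup>+\<^sup>1\<close> or as \<open>y\<^sup>k\<^sup>+\<^sup>1 a\<^sup>k\<close>, and both \<open>a d\<close> and \<open>d a\<close> reduce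
  to \<open>a\<^sup>k x\<^sup>k\<close>.
\<close>

lemma drazin_inverse_if_strongly_pi_regular:
  assumes c: "a \<in> carrier G" "x \<in> carrier G" "y \<in> carrier G"
    and x: "a [^] k = a [^] Suc k \<otimes> x" and y: "a [^] k = y \<otimes> a [^] Suc k"
  defines "d \<equiv> a [^] k \<otimes> x [^] Suc k"
  shows "d \<otimes> a \<otimes> d = d" and "a \<otimes> d = d \<otimes> a" and "a [^] Suc k \<otimes> d = a [^] k"
proof -
  have d: "d \<in> carrier G"
    unfolding d_def using c by simp
  have swap: "a [^] k \<otimes> x [^] j = y [^] j \<otimes> a [^] k" for j :: nat
  proof (induction j)
    case (Suc j)
    have "a [^] k \<otimes> x = y \<otimes> a [^] k"
      by (metis x y c m_assoc nat_pow_closed)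
    hence "y [^] j \<otimes> a [^] k \<otimes> x = y [^] j \<otimes> y \<otimes> a [^] k"
      using c by (simp add: m_assoc)
    thus ?case
      using Suc c by (simp flip: m_assoc)
  qed (use c in simp)
  have cancel: "a [^] j \<otimes> a [^] k \<otimes> x [^] j = a [^] k" for j :: nat
  proof (induction j)
    case (Suc j)
    have "a [^] Suc j \<otimes> a [^] k \<otimes> x [^] Suc j = a [^] j \<otimes> (a [^] Suc k \<otimes> x) \<otimes> x [^] j"
      unfolding nat_pow_Suc2[OF c(1), of k] nat_pow_Suc2[OF c(2), of j] nat_pow_Suc[of a j]
      using c by (simp add: m_assoc)
    thus ?case
      unfolding x[symmetric] using Suc by simp
  qed (use c in simp)
  have ad: "a \<otimes> d = a [^] k \<otimes> x [^] k"
  proof -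
    have "a \<otimes> d = a [^] Suc k \<otimes> x \<otimes> x [^] k"
      unfolding d_def nat_pow_Suc2[OF c(1), of k] nat_pow_Suc2[OF c(2), of k]
      using c by (simp add: m_assoc)
    thus ?thesis
      unfolding x[symmetric] .
  qed
  have "d \<otimes> a = y [^] k \<otimes> (y \<otimes> a [^] Suc k)"
    unfolding d_def swap using c by (simp add: m_assoc)
  thus comm: "a \<otimes> d = d \<otimes> a"
    unfolding y[symmetric] ad swap by simp
  have "d \<otimes> a \<otimes> d = d \<otimes> (a [^] k \<otimes> x [^] k)"
    using c d ad by (simp add: m_assoc)
  also have "\<dots> = y [^] Suc k \<otimes> (a [^] k \<otimes> a [^] k \<otimes> x [^] k)"
    unfolding d_def swap[of "Suc k"] using c by (simp add: m_assoc)
  also have "\<dots> = d"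
    unfolding cancel d_def swap[of "Suc k"] ..
  finally show "d \<otimes> a \<otimes> d = d" .
  have "a [^] Suc k \<otimes> d = a [^] k \<otimes> a [^] k \<otimes> x [^] k"
    using c d ad by (simp add: m_assoc)
  thus "a [^] Suc k \<otimes> d = a [^] k"
    unfolding cancel .
qed

end

section \<open>The Drazin inverse of a matrix\<close>

lemma monoid_mat: "monoid (ring_mat TYPE(complex) n ())"
  by (rule semiring.axioms(2)[OF semiring_mat])

text \<open>
  The ranks of the powers decrease, so they cannot drop strictly at every step; the minimum that
  defines the index is therefore attained.
\<close>

lemma mat_rank_pow_mat_index:
  assumes A: "A \<in> carrier_mat n n"
  shows "vec_space.rank n (A ^\<^sub>m Suc (mat_index A)) = vec_space.rank n (A ^\<^sub>m mat_index A)"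
proof -
  let ?r = "\<lambda>k. vec_space.rank n (A ^\<^sub>m k)"
  have dec: "?r (Suc k) \<le> ?r k" for k
    using A by (simp add: rank_mult_le[of _ n n _ n])
  have "\<exists>k. ?r (Suc k) = ?r k"
  proof (rule ccontr)
    assume "\<not> ?thesis"
    hence less: "?r (Suc k) < ?r k" for k
      using dec[of k] by (metis le_neq_implies_less)
    have "?r k + k \<le> ?r 0" for k
    proof (induction k)
      case (Suc k)
      thus ?case
        using less[of k] by linarith
    qed simp
    from this[of "Suc (?r 0)"] show False
      by simp
  qed
  hence "?r (Suc (LEAST k. ?r (Suc k) = ?r k)) = ?r (LEAST k. ?r (Suc k) = ?r k)"
    by (rule LeastI_ex)
  moreover have "mat_index A = (LEAST k. ?r (Suc k) = ?r k)"
    unfolding mat_index_def pow_mat_dim(1) carrier_matD(1)[OF A] Suc_eq_plus1 ..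
  ultimately show ?thesis
    by (simp only:)
qed

lemma is_drazin_inverse_iff:
  assumes "A \<in> carrier_mat n n"
  shows "is_drazin_inverse A X \<longleftrightarrow> X \<in> carrier_mat n n \<and> X * A * X = X \<and> A * X = X * A \<and>
    A ^\<^sub>m Suc (mat_index A) * X = A ^\<^sub>m mat_index A"
  using carrier_matD(1)[OF assms] unfolding is_drazin_inverse_def Suc_eq_plus1 by blast

lemma is_drazin_inverse_unique:
  assumes A: "A \<in> carrier_mat n n" and X: "is_drazin_inverse A X"
    and Y: "Y \<in> carrier_mat n n" "Y * A * Y = Y" "A * Y = Y * A" "A ^\<^sub>m Suc k * Y = A ^\<^sub>m k"
  shows "X = Y"
proof -
  interpret monoid "ring_mat TYPE(complex) n ()"
    by (rule monoid_mat)
  note transfer = ring_mat_simps pow_mat_ring_pow[OF A, of _ "()", symmetric]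
  show ?thesis
    using X drazin_inverse_unique[of A X Y "mat_index A" k, unfolded transfer,
      OF A _ Y(1) _ _ _ Y(2-4)]
    unfolding is_drazin_inverse_iff[OF A] by blast
qed

lemma drazin_inverse_exists:
  assumes A: "A \<in> carrier_mat n n"
  shows "\<exists>X. is_drazin_inverse A X"
proof -
  interpret monoid "ring_mat TYPE(complex) n ()"
    by (rule monoid_mat)
  let ?k = "mat_index A"
  have Ak: "A ^\<^sub>m ?k \<in> carrier_mat n n" "A ^\<^sub>m Suc ?k \<in> carrier_mat n n"
    using A by (rule pow_carrier_mat)+
  note transfer = ring_mat_simps pow_mat_ring_pow[OF A, of _ "()", symmetric]
  have Suc2: "A ^\<^sub>m Suc ?k = A * A ^\<^sub>m ?k"
    using nat_pow_Suc2[of A ?k, unfolded transfer] A by blast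
  have rank: "vec_space.rank n (A ^\<^sub>m ?k * A) = vec_space.rank n (A ^\<^sub>m ?k)"
    "vec_space.rank n (A * A ^\<^sub>m ?k) = vec_space.rank n (A ^\<^sub>m ?k)"
    using mat_rank_pow_mat_index[OF A] unfolding Suc2[symmetric] by simp_all
  obtain U where U: "U \<in> carrier_mat n n" "A ^\<^sub>m ?k = A ^\<^sub>m Suc ?k * U"
    using right_factor_if_rank_mult_eq[OF Ak(1) A rank(1)] unfolding pow_mat.simps(2) by blast
  obtain V where V: "V \<in> carrier_mat n n" "A ^\<^sub>m ?k = V * A ^\<^sub>m Suc ?k"
    using left_factor_if_rank_mult_eq[OF Ak(1) A rank(2)] unfolding Suc2 by blast
  let ?D = "A ^\<^sub>m ?k * U ^\<^sub>m Suc ?k"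
  have "?D * A * ?D = ?D" "A * ?D = ?D * A" "A ^\<^sub>m Suc ?k * ?D = A ^\<^sub>m ?k"
    using drazin_inverse_if_strongly_pi_regular[of A U V ?k, unfolded transfer
      pow_mat_ring_pow[OF U(1), of _ "()", symmetric], OF A U(1) V(1) U(2) V(2)]
    by blast+
  moreover have "?D \<in> carrier_mat n n"
    using Ak(1) pow_carrier_mat[OF U(1)] by (rule mult_carrier_mat)
  ultimately have "is_drazin_inverse A ?D"
    unfolding is_drazin_inverse_iff[OF A] by blast
  thus ?thesis
    by blast
qed

lemma is_drazin_inverse_drazin_inverse:
  assumes A: "A \<in> carrier_mat n n"
  shows "is_drazin_inverse A (drazin_inverse A)"
proof -
  obtain X where X: "is_drazin_inverse A X"
    using drazin_inverse_exists[OF A] by blast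
  have "Y = X" if "is_drazin_inverse A Y" for Y
    using is_drazin_inverse_unique[OF A that, of X "mat_index A"] X
    unfolding is_drazin_inverse_iff[OF A] by blast
  with X show ?thesis
    unfolding drazin_inverse_def by (rule theI)
qed

text \<open>
  Any exponent \<open>k\<close> will do, so the index of \<open>A\<close> need not be known.
\<close>

lemma drazin_inverse_eqI:
  assumes "A \<in> carrier_mat n n" "X \<in> carrier_mat n n"
    and "X * A * X = X" "A * X = X * A" "A ^\<^sub>m Suc k * X = A ^\<^sub>m k"
  shows "drazin_inverse A = X"
  using is_drazin_inverse_unique is_drazin_inverse_drazin_inverse assms by blast

section \<open>Extending a matrix on the range of a projector by the identity\<close>

text \<open>
  For a projector \<open>P\<close> whose range is invariant under \<open>T\<close>, this is the matrix acting as \<open>T\<close> on the range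
  of \<open>P\<close> and as the identity on its kernel.
\<close>

definition extend_by_identity :: "complex mat \<Rightarrow> complex mat \<Rightarrow> complex mat" where
  "extend_by_identity P T = 1\<^sub>m (dim_row P) - P + T * P"

lemma extend_by_identity_carrier [simp]:
  "P \<in> carrier_mat n n \<Longrightarrow> T \<in> carrier_mat n n \<Longrightarrow> extend_by_identity P T \<in> carrier_mat n n"
  unfolding extend_by_identity_def by auto

text \<open>
  The identity \<open>P * (T * P) = T * P\<close> says that the range of \<open>P\<close> is invariant under \<open>T\<close>. Then
  \<open>(1 - P) T P = 0\<close>, and \<open>S P (1 - P) = 0\<close> by idempotency, so both mixed terms of the product vanish.
\<close>

lemma extend_by_identity_mult:
  assumes P: "P \<in> carrier_mat n n" and S: "S \<in> carrier_mat n n" and T: "T \<in> carrier_mat n n"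
    and idem: "P * P = P" and inv: "P * (T * P) = T * P"
  shows "extend_by_identity P S * extend_by_identity P T = extend_by_identity P (S * T)"
proof -
  let ?Q = "1\<^sub>m n - P"
  have Q: "?Q \<in> carrier_mat n n"
    using P by (rule minus_carrier_mat)
  have PQ: "P * ?Q = 0\<^sub>m n n"
    using P idem mult_minus_distrib_mat[of P n n "1\<^sub>m n" n P] by simp
  have QT: "?Q * (T * P) = 0\<^sub>m n n"
    using P T inv minus_mult_distrib_mat[of "1\<^sub>m n" n n P "T * P" n] by simp
  have QQ: "?Q * ?Q = ?Q"
  proof -
    have "?Q * ?Q = ?Q - 0\<^sub>m n n"
      using minus_mult_distrib_mat[of "1\<^sub>m n" n n P ?Q n] PQ P Q by simp
    also have "\<dots> = ?Q"
      using P by (intro eq_matI) auto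
    finally show ?thesis .
  qed
  have SPQ: "S * P * ?Q = 0\<^sub>m n n"
    using PQ P Q S by simp
  have "S * P * (T * P) = S * (P * (T * P))"
    using P S T by (intro assoc_mult_mat[of _ n n _ n _ n]) auto
  also have "\<dots> = S * T * P"
    unfolding inv using P S T by simp
  finally have SPTP: "S * P * (T * P) = S * T * P" .
  have "(?Q + S * P) * (?Q + T * P) = ?Q * ?Q + S * P * ?Q + (?Q * (T * P) + S * P * (T * P))"
    using P S T Q
    by (simp add: add_mult_distrib_mat[of _ n n _ _ n] mult_add_distrib_mat[of _ n n _ n])
  also have "\<dots> = ?Q + S * T * P"
    unfolding QQ SPQ QT SPTP using P Q S T by simp
  finally show ?thesis
    using P unfolding extend_by_identity_def by simp
qed

text \<open>
  The range of \<open>P\<close> contains that of \<open>A\<close> and hence that of the Drazin inverse \<open>D = A D D\<close>. Multiplicativity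
  then transports the defining equations of \<open>D\<close>, with the same exponent.
\<close>

lemma drazin_inverse_extend_by_identity:
  assumes A: "A \<in> carrier_mat n n" and P: "P \<in> carrier_mat n n"
    and idem: "P * P = P" and PA: "P * A = A"
  shows "drazin_inverse (extend_by_identity P A) = extend_by_identity P (drazin_inverse A)"
    and "P * drazin_inverse A = drazin_inverse A"
proof -
  let ?c = "extend_by_identity P"
  define D where "D = drazin_inverse A"
  define k where "k = mat_index A"
  have D: "D \<in> carrier_mat n n" and DAD: "D * A * D = D" and AD: "A * D = D * A"
    and Ak: "A ^\<^sub>m Suc k * D = A ^\<^sub>m k"
    using is_drazin_inverse_drazin_inverse[OF A]
    unfolding is_drazin_inverse_iff[OF A] D_def k_def by blast+
  note rules = A P D
  note closed = mult_carrier_mat[of _ n n _ n]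
  note assoc = assoc_mult_mat[of _ n n _ n _ n] closed
  have D2: "A * D * D = D"
    using DAD AD by simp
  have "P * D = P * (A * D * D)"
    unfolding D2 ..
  also have "\<dots> = P * A * D * D"
    using rules by (simp add: assoc)
  finally show PD: "P * drazin_inverse A = drazin_inverse A"
    unfolding PA D2 unfolding D_def .
  hence PD: "P * D = D"
    unfolding D_def .
  have inv: "P * (A * P) = A * P" "P * (D * P) = D * P"
    unfolding assoc_mult_mat[OF P A P, symmetric] assoc_mult_mat[OF P D P, symmetric] PA PD
    by (rule refl)+
  have mult: "?c S * ?c A = ?c (S * A)" "?c S * ?c D = ?c (S * D)"
    if "S \<in> carrier_mat n n" for S
    using extend_by_identity_mult[OF P that A idem inv(1)]
      extend_by_identity_mult[OF P that D idem inv(2)] by auto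
  have pow: "?c A ^\<^sub>m j = ?c (A ^\<^sub>m j)" for j
  proof (induction j)
    case 0
    show ?case
      using A P by (auto simp: extend_by_identity_def)
  next
    case (Suc j)
    thus ?case
      using mult(1)[of "A ^\<^sub>m j"] A by simp
  qed
  show "drazin_inverse (?c A) = ?c (drazin_inverse A)"
    unfolding D_def[symmetric]
  proof (rule drazin_inverse_eqI[of _ n _ k])
    show "?c D * ?c A * ?c D = ?c D"
      using mult A D DAD by simp
    show "?c A * ?c D = ?c D * ?c A"
      using mult A D AD by simp
    show "?c A ^\<^sub>m Suc k * ?c D = ?c A ^\<^sub>m k"
      unfolding pow mult(2)[OF pow_carrier_mat[OF A]] Ak ..
  qed (use A P D in auto)
qed

section \<open>The m-DMP inverse\<close>

theorem theorem4p3: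
  fixes A Abar :: "complex mat" and n k :: nat
  assumes "n \<ge> 1"
    and "A \<in> carrier_mat n n"
    and "mat_index A = k"
    and "mat_rank (minkowski_adjoint A * A * minkowski_adjoint A) = mat_rank A"
    and "Abar = 1\<^sub>m n - A"
  shows "m_DMP_inverse A =
           A * minkowski_inverse A * drazin_inverse (1\<^sub>m n - Abar * A * minkowski_inverse A) \<and>
         A * minkowski_inverse A * drazin_inverse (1\<^sub>m n - Abar * A * minkowski_inverse A) =
           drazin_inverse (1\<^sub>m n - Abar * A * minkowski_inverse A) * A * minkowski_inverse A"
proof -
  define M where "M = minkowski_inverse A"
  define D where "D = drazin_inverse A"
  define P where "P = A * M"
  let ?B = "1\<^sub>m n - Abar * A * M"
  note A = assms(2)
  have "dim_row (minkowski_adjoint A * A * minkowski_adjoint A) = n"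
    using minkowski_adjoint_carrier[OF A] by simp
  hence "is_minkowski_inverse A M"
    unfolding M_def using is_minkowski_inverse_minkowski_inverse[OF A] assms(4) A by simp
  hence M: "M \<in> carrier_mat n n" and PA: "P * A = A"
    using A unfolding is_minkowski_inverse_def P_def by auto
  have D: "D \<in> carrier_mat n n"
    using is_drazin_inverse_drazin_inverse[OF A] unfolding is_drazin_inverse_iff[OF A] D_def
    by blast
  have P: "P \<in> carrier_mat n n"
    unfolding P_def using A M by simp
  have "P * P = P * A * M"
    by (simp only: assoc_mult_mat[OF P A M] P_def[symmetric])
  hence idem: "P * P = P"
    unfolding PA by (simp add: P_def)
  have "?B = 1\<^sub>m n - (P - A * P)"
    using A M P unfolding assms(5) P_def
    by (simp add: minus_mult_distrib_mat[of _ n n] assoc_mult_mat[of _ n n _ n _ n])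
  also have "\<dots> = extend_by_identity P A"
    using A P unfolding extend_by_identity_def by (intro eq_matI) auto
  finally have B: "drazin_inverse ?B = extend_by_identity P D"
    using drazin_inverse_extend_by_identity(1)[OF A P idem PA] unfolding D_def by simp
  have PD: "P * D = D"
    using drazin_inverse_extend_by_identity(2)[OF A P idem PA] unfolding D_def .
  have Q: "1\<^sub>m n - P \<in> carrier_mat n n"
    using P by (rule minus_carrier_mat)
  have PQ: "P * (1\<^sub>m n - P) = 0\<^sub>m n n" "(1\<^sub>m n - P) * P = 0\<^sub>m n n"
    using P idem mult_minus_distrib_mat[of P n n "1\<^sub>m n" n P]
      minus_mult_distrib_mat[of "1\<^sub>m n" n n P P n] by simp_all
  have "P * extend_by_identity P D = P * (1\<^sub>m n - P) + P * (D * P)"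
    using P D Q unfolding extend_by_identity_def by (simp add: mult_add_distrib_mat[of _ n n _ n])
  also have "P * (D * P) = P * D * P"
    using P D by simp
  finally have left: "P * extend_by_identity P D = D * P"
    unfolding PQ PD using P D by simp
  have "extend_by_identity P D * P = (1\<^sub>m n - P) * P + D * P * P"
    using P D Q unfolding extend_by_identity_def by (simp add: add_mult_distrib_mat[of _ n n _ _ n])
  also have "D * P * P = D * P"
    using P D idem by simp
  finally have right: "extend_by_identity P D * P = D * P"
    unfolding PQ using P D by simp
  have "m_DMP_inverse A = D * P"
    unfolding m_DMP_inverse_def P_def D_def[symmetric] M_def[symmetric] using A M D by simp
  moreover have "drazin_inverse ?B * A * M = extend_by_identity P D * (A * M)"
    unfolding B using P D by (intro assoc_mult_mat[of _ n n _ n _ n] A M) simp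
  ultimately show ?thesis
    unfolding M_def[symmetric] B P_def[symmetric] left right by metis
qed

end
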